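(* Let $(X,\gamma,H)$ be an abstract Wiener space, let $\Omega\subset X$ be an open convex set, and let $\mathcal F$ be a countable family of finite-dimensional subspaces of $QX^*$, stable under finite unions (i.e. the linear span of the union of finitely many members of $\mathcal F$ belongs to $\mathcal F$), such that $\bigcup_{F\in\mathcal F}F$ is dense in $H$. Then $\partial^*_{\mathcal F}\Omega=\partial\Omega$, where $\partial\Omega$ is the topological boundary of $\Omega$.
   Context: $X$ is a separable infinite-dimensional Banach space, $\gamma$ a centered nondegenerate Radon Gaussian measure on $X$, $H\subset X$ its Cameron–Martin space (continuously and densely embedded in $X$), $Q:X^*\to X$ the covariance operator, $QX^*\subset H$ dense. For $h=Qx^*$ write $\hat h=x^*$. For a finite-dimensional $F\subset QX^*$ with $H$-orthonormal basis $h_1,\dots,h_m$, $\pi_F(x)=\sum_{i=1}^m\hat h_i(x)h_i$, so that $X=\ker(\pi_F)\oplus F$; for $y\in\ker(\pi_F)$, $\Omega_y=\{z\in F:y+z\in\Omega\}$. For a set $E$ in the finite-dimensional Euclidean space $F\cong\mathbb R^m$, $\partial^*E$ denotes the essential boundary, i.e. the set of points at which $E$ has neither Lebesgue density $0$ nor Lebesgue density $1$. Define $$\partial_F^*\Omega=\{y+z: y\in\ker(\pi_F),\ z\in\partial^*(\Omega_y)\},\qquad \partial^*_{\mathcal F}\Omega=\bigcup_{F\in\mathcal F}\ \bigcap_{G\in\mathcal F,\,G\supset F}\partial_G^*\Omega .$$ *)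

theory Defs
  imports "HOL-Probability.Probability"
begin

text \<open>The dual \<open>X\<^sup>*\<close> of \<open>X\<close> is the type of bounded linear maps \<open>'a \<Rightarrow>\<^sub>L real\<close>.\<close>

definition radon_gaussian_measure :: "'a::{banach, second_countable_topology} measure \<Rightarrow> bool" where
  "radon_gaussian_measure \<gamma> \<longleftrightarrow>
     prob_space \<gamma> \<and> sets \<gamma> = sets borel \<and>
     (\<forall>A \<in> sets borel. emeasure \<gamma> A = (SUP K\<in>{K. compact K \<and> K \<subseteq> A}. emeasure \<gamma> K)) \<and>
     (\<forall>f :: 'a \<Rightarrow>\<^sub>L real. \<exists>m \<sigma>. \<sigma> \<ge> 0 \<and>
        distr \<gamma> borel (blinfun_apply f) =
          (if \<sigma> = 0 then return borel m else density lborel (normal_density m \<sigma>)))"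

definition centered_measure :: "'a::{banach, second_countable_topology} measure \<Rightarrow> bool" where
  "centered_measure \<gamma> \<longleftrightarrow> (\<forall>f :: 'a \<Rightarrow>\<^sub>L real. (\<integral>x. f x \<partial>\<gamma>) = 0)"

text \<open>Nondegenerate: not concentrated on any proper closed subspace.\<close>

definition nondegenerate_measure :: "'a::{banach, second_countable_topology} measure \<Rightarrow> bool" where
  "nondegenerate_measure \<gamma> \<longleftrightarrow>
     (\<forall>V. subspace V \<and> closed V \<and> emeasure \<gamma> V = 1 \<longrightarrow> V = UNIV)"

text \<open>The covariance operator is the bounded operator \<open>Q : X\<^sup>* \<rightarrow> X\<close> uniquely determined by
  the following identity.\<close>

definition covariance_operator ::
    "'a::{banach, second_countable_topology} measure \<Rightarrow> (('a \<Rightarrow>\<^sub>L real) \<Rightarrow>\<^sub>L 'a) \<Rightarrow> bool" where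
  "covariance_operator \<gamma> Q \<longleftrightarrow>
     (\<forall>f g :: 'a \<Rightarrow>\<^sub>L real. g (Q f) = (\<integral>x. f x * g x \<partial>\<gamma>))"

text \<open>The Cameron-Martin space is determined by \<open>\<gamma>\<close> and so is not a separate parameter.\<close>

locale abstract_wiener_space =
  fixes \<gamma> :: "'a::{banach, second_countable_topology} measure"
    and Q :: "('a \<Rightarrow>\<^sub>L real) \<Rightarrow>\<^sub>L 'a"
  assumes infinite_dim: "\<not> (\<exists>B :: 'a set. finite B \<and> span B = UNIV)"
    and gaussian: "radon_gaussian_measure \<gamma>"
    and centered: "centered_measure \<gamma>"
    and nondegenerate: "nondegenerate_measure \<gamma>"
    and covariance: "covariance_operator \<gamma> Q"

text \<open>The closure of \<open>X\<^sup>*\<close> in \<open>L\<^sup>2(\<gamma>)\<close>, as a set of functions rather than of classes.\<close>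

definition dual_L2_closure ::
    "'a::{banach, second_countable_topology} measure \<Rightarrow> ('a \<Rightarrow> real) set" where
  "dual_L2_closure \<gamma> =
     {f \<in> borel_measurable \<gamma>. integrable \<gamma> (\<lambda>x. (f x)\<^sup>2) \<and>
        (\<forall>\<epsilon>>0. \<exists>g :: 'a \<Rightarrow>\<^sub>L real. (\<integral>x. (f x - g x)\<^sup>2 \<partial>\<gamma>) < \<epsilon>)}"

text \<open>\<open>cm_represents \<gamma> f h\<close> says that \<open>h\<close> is the weak integral of \<open>x \<mapsto> f(x) x\<close>; such an \<open>f\<close> is
  unique up to \<open>\<gamma>\<close>-null sets. The Cameron-Martin space carries the inner product of
  \<open>L\<^sup>2(\<gamma>)\<close> transported along this correspondence.\<close>

definition cm_represents ::
    "'a::{banach, second_countable_topology} measure \<Rightarrow> ('a \<Rightarrow> real) \<Rightarrow> 'a \<Rightarrow> bool" where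
  "cm_represents \<gamma> f h \<longleftrightarrow>
     f \<in> dual_L2_closure \<gamma> \<and> (\<forall>g :: 'a \<Rightarrow>\<^sub>L real. g h = (\<integral>x. f x * g x \<partial>\<gamma>))"

definition cm_space :: "'a::{banach, second_countable_topology} measure \<Rightarrow> 'a set" where
  "cm_space \<gamma> = {h. \<exists>f. cm_represents \<gamma> f h}"

definition cm_inner :: "'a::{banach, second_countable_topology} measure \<Rightarrow> 'a \<Rightarrow> 'a \<Rightarrow> real" where
  "cm_inner \<gamma> h k =
     (\<integral>x. (SOME f. cm_represents \<gamma> f h) x * (SOME f. cm_represents \<gamma> f k) x \<partial>\<gamma>)"

definition cm_norm :: "'a::{banach, second_countable_topology} measure \<Rightarrow> 'a \<Rightarrow> real" where
  "cm_norm \<gamma> h = sqrt (cm_inner \<gamma> h h)"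

definition cm_dense :: "'a::{banach, second_countable_topology} measure \<Rightarrow> 'a set \<Rightarrow> bool" where
  "cm_dense \<gamma> D \<longleftrightarrow>
     D \<subseteq> cm_space \<gamma> \<and> (\<forall>h \<in> cm_space \<gamma>. \<forall>\<epsilon>>0. \<exists>d\<in>D. cm_norm \<gamma> (h - d) < \<epsilon>)"

text \<open>\<open>hat Q h\<close> is the functional \<open>x\<^sup>*\<close> with \<open>h = Q x\<^sup>*\<close>; it is meaningful for \<open>h\<close> in the range
  of \<open>Q\<close>, where nondegeneracy makes \<open>x\<^sup>*\<close> unique.\<close>

definition hat :: "(('a::{banach, second_countable_topology} \<Rightarrow>\<^sub>L real) \<Rightarrow>\<^sub>L 'a) \<Rightarrow> 'a \<Rightarrow> 'a \<Rightarrow>\<^sub>L real" where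
  "hat Q h = (THE f. Q f = h)"

definition cm_orthonormal_basis ::
    "'a::{banach, second_countable_topology} measure \<Rightarrow> 'a set \<Rightarrow> 'a set \<Rightarrow> bool" where
  "cm_orthonormal_basis \<gamma> F B \<longleftrightarrow>
     finite B \<and> span B = F \<and> (\<forall>h\<in>B. \<forall>k\<in>B. cm_inner \<gamma> h k = (if h = k then 1 else 0))"

text \<open>An arbitrary orthonormal basis of \<open>F\<close>; the notions below do not depend on the choice.\<close>

definition cm_basis ::
    "'a::{banach, second_countable_topology} measure \<Rightarrow> 'a set \<Rightarrow> 'a set" where
  "cm_basis \<gamma> F = (SOME B. cm_orthonormal_basis \<gamma> F B)"

definition cm_proj ::
    "'a::{banach, second_countable_topology} measure \<Rightarrow> (('a \<Rightarrow>\<^sub>L real) \<Rightarrow>\<^sub>L 'a) \<Rightarrow> 'a set \<Rightarrow> 'a \<Rightarrow> 'a" where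
  "cm_proj \<gamma> Q F x = (\<Sum>h\<in>cm_basis \<gamma> F. hat Q h x *\<^sub>R h)"

text \<open>Lebesgue measure on the Euclidean space \<open>F\<close>, as a measure on \<open>X\<close> concentrated on \<open>F\<close>:
  the image of Lebesgue measure on coordinate vectors indexed by the orthonormal basis.\<close>

definition lebesgue_on_subspace ::
    "'a::{banach, second_countable_topology} measure \<Rightarrow> 'a set \<Rightarrow> 'a measure" where
  "lebesgue_on_subspace \<gamma> F =
     completion (distr (\<Pi>\<^sub>M h\<in>cm_basis \<gamma> F. lborel) borel (\<lambda>c. \<Sum>h\<in>cm_basis \<gamma> F. c h *\<^sub>R h))"

definition cm_ball ::
    "'a::{banach, second_countable_topology} measure \<Rightarrow> 'a set \<Rightarrow> 'a \<Rightarrow> real \<Rightarrow> 'a set" where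
  "cm_ball \<gamma> F z r = {w \<in> F. cm_norm \<gamma> (w - z) < r}"

definition has_lebesgue_density ::
    "'a::{banach, second_countable_topology} measure \<Rightarrow> 'a set \<Rightarrow> 'a set \<Rightarrow> 'a \<Rightarrow> real \<Rightarrow> bool" where
  "has_lebesgue_density \<gamma> F E z d \<longleftrightarrow>
     ((\<lambda>r. measure (lebesgue_on_subspace \<gamma> F) (E \<inter> cm_ball \<gamma> F z r) /
           measure (lebesgue_on_subspace \<gamma> F) (cm_ball \<gamma> F z r)) \<longlongrightarrow> d) (at_right 0)"

definition essential_boundary ::
    "'a::{banach, second_countable_topology} measure \<Rightarrow> 'a set \<Rightarrow> 'a set \<Rightarrow> 'a set" where
  "essential_boundary \<gamma> F E =
     {z \<in> F. \<not> has_lebesgue_density \<gamma> F E z 0 \<and> \<not> has_lebesgue_density \<gamma> F E z 1}"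

definition section_at :: "'a::real_vector set \<Rightarrow> 'a set \<Rightarrow> 'a \<Rightarrow> 'a set" where
  "section_at F \<Omega> y = {z \<in> F. y + z \<in> \<Omega>}"

definition subspace_essential_boundary ::
    "'a::{banach, second_countable_topology} measure \<Rightarrow> (('a \<Rightarrow>\<^sub>L real) \<Rightarrow>\<^sub>L 'a) \<Rightarrow> 'a set \<Rightarrow> 'a set \<Rightarrow> 'a set" where
  "subspace_essential_boundary \<gamma> Q F \<Omega> =
     {y + z | y z. cm_proj \<gamma> Q F y = 0 \<and> z \<in> essential_boundary \<gamma> F (section_at F \<Omega> y)}"

definition family_essential_boundary ::
    "'a::{banach, second_countable_topology} measure \<Rightarrow> (('a \<Rightarrow>\<^sub>L real) \<Rightarrow>\<^sub>L 'a) \<Rightarrow> 'a set set \<Rightarrow> 'a set \<Rightarrow> 'a set" where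
  "family_essential_boundary \<gamma> Q \<F> \<Omega> =
     (\<Union>F\<in>\<F>. \<Inter>G\<in>{G \<in> \<F>. F \<subseteq> G}. subspace_essential_boundary \<gamma> Q G \<Omega>)"

end

theory Submission
  imports Defs
begin

text \<open>If \<open>x = y + z\<close> lies in \<open>\<Omega>\<close> or outside its closure, then the section \<open>\<Omega>\<^sub>y\<close> has density 1 or 0
  at \<open>z\<close> in every \<open>F\<close>, since the Cameron-Martin norm dominates the norm of \<open>X\<close> on \<open>F\<close>.
  Conversely, let \<open>x \<in> \<partial>\<Omega>\<close>. The union of the family is dense in \<open>X\<close>: a functional \<open>f\<close>
  vanishing on it satisfies \<open>\<bar>Qf - d\<bar>\<^sup>2 = \<bar>Qf\<bar>\<^sup>2 + \<bar>d\<bar>\<^sup>2\<close> in \<open>H\<close> for all \<open>d\<close> in it,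
  so \<open>Qf = 0\<close> by density in \<open>H\<close>. Hence \<open>x + F\<close> meets the open set \<open>\<Omega>\<close> for some \<open>F\<close>, and so does \<open>x + G\<close> for all \<open>G \<supseteq> F\<close>. The section of \<open>\<Omega>\<close> along such a \<open>G\<close> then
  contains an open cone with vertex at \<open>x\<close>, and by convexity its complement contains
  the reflected cone. Both have positive lower density at the vertex, which is seen by
  comparing balls with coordinate cubes, whose volume is explicit.\<close>

section \<open>The Hahn-Banach theorem\<close>

definition sublinear :: "('a::real_vector \<Rightarrow> real) \<Rightarrow> bool" where
  "sublinear p \<longleftrightarrow> (\<forall>x y. p (x + y) \<le> p x + p y) \<and> (\<forall>a\<ge>0. \<forall>x. p (a *\<^sub>R x) = a * p x)"

text \<open>One inequality for positive scalars suffices: applied to \<open>inverse a\<close> and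
  \<open>a *\<^sub>R x\<close>, it yields the converse inequality.\<close>

lemma sublinearI:
  assumes add: "\<And>x y. p (x + y) \<le> p x + p y"
    and zero: "p 0 = 0"
    and scale: "\<And>a x. a > 0 \<Longrightarrow> p (a *\<^sub>R x) \<le> a * p x"
  shows "sublinear p"
proof -
  have "p (a *\<^sub>R x) = a * p x" if "a \<ge> 0" for a x
  proof (cases "a = 0")
    case False
    with that have a: "a > 0" by simp
    have "p x \<le> inverse a * p (a *\<^sub>R x)"
      using scale[of "inverse a" "a *\<^sub>R x"] a by simp
    then show ?thesis
      using scale[OF a, of x] a by (simp add: field_simps)
  qed (simp add: zero)
  then show ?thesis
    using add by (simp add: sublinear_def)
qed

lemma sublinear_add: "sublinear p \<Longrightarrow> p (x + y) \<le> p x + p y"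
  and sublinear_scale: "sublinear p \<Longrightarrow> a \<ge> 0 \<Longrightarrow> p (a *\<^sub>R x) = a * p x"
  by (auto simp: sublinear_def)

lemma sublinear_zero: "sublinear p \<Longrightarrow> p 0 = 0"
  using sublinear_scale[of p 0 0] by simp

lemma sublinear_minus: "sublinear p \<Longrightarrow> - p (- x) \<le> p x"
  using sublinear_add[of p x "- x"] by (simp add: sublinear_zero)

text \<open>For sublinear \<open>p\<close> this is the largest sublinear functional below
  \<open>p\<close> whose value at \<open>- v\<close> is at most \<open>- p v\<close>. Any such
  \<open>q\<close> satisfies \<open>q x \<le> q (x + t *\<^sub>R v) + t * q (- v)\<close>, which is
  at most the term of index \<open>t\<close>.\<close>

definition sublinear_lower :: "('a::real_vector \<Rightarrow> real) \<Rightarrow> 'a \<Rightarrow> 'a \<Rightarrow> real" where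
  "sublinear_lower p v x = (INF t\<in>{0..}. p (x + t *\<^sub>R v) - t * p v)"

lemma
  assumes p: "sublinear p"
  shows sublinear_lower_le: "t \<ge> 0 \<Longrightarrow> sublinear_lower p v x \<le> p (x + t *\<^sub>R v) - t * p v"
    and sublinear_sublinear_lower: "sublinear (sublinear_lower p v)"
proof -
  \<comment> \<open>A real infimum is only meaningful for a set bounded below. The bound comes from
    writing \<open>t *\<^sub>R v\<close> as the sum of \<open>x + t *\<^sub>R v\<close> and
    \<open>- x\<close>.\<close>
  have lb: "- p (- x) \<le> p (x + t *\<^sub>R v) - t * p v" if "t \<ge> 0" for t x
    using sublinear_add[OF p, of "x + t *\<^sub>R v" "- x"] sublinear_scale[OF p that, of v]
    by simp
  then have bdd: "bdd_below ((\<lambda>t. p (x + t *\<^sub>R v) - t * p v) ` {0..})" for x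
    by (intro bdd_belowI2[where m="- p (- x)"]) auto
  show le: "sublinear_lower p v x \<le> p (x + t *\<^sub>R v) - t * p v" if "t \<ge> 0" for t x
    unfolding sublinear_lower_def using that bdd by (intro cINF_lower) auto
  have ge: "m \<le> sublinear_lower p v x"
    if "\<And>t. t \<ge> 0 \<Longrightarrow> m \<le> p (x + t *\<^sub>R v) - t * p v" for m x
    unfolding sublinear_lower_def using that by (intro cINF_greatest) auto
  show "sublinear (sublinear_lower p v)"
  proof (rule sublinearI)
    fix x y
    \<comment> \<open>The two infima are taken one after the other: \<open>t\<close> stays fixed
      while \<open>s\<close> varies, and the term of index \<open>s + t\<close> is the one used for
      \<open>x + y\<close>.\<close>
    have "sublinear_lower p v (x + y) - (p (y + t *\<^sub>R v) - t * p v) \<le> sublinear_lower p v x"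
      if t: "t \<ge> 0" for t
    proof (rule ge)
      fix s :: real assume s: "s \<ge> 0"
      have "p ((x + y) + (s + t) *\<^sub>R v) \<le> p (x + s *\<^sub>R v) + p (y + t *\<^sub>R v)"
        using sublinear_add[OF p, of "x + s *\<^sub>R v" "y + t *\<^sub>R v"]
        by (simp add: algebra_simps)
      then show "sublinear_lower p v (x + y) - (p (y + t *\<^sub>R v) - t * p v)
          \<le> p (x + s *\<^sub>R v) - s * p v"
        using le[of "s + t" "x + y"] s t by (simp add: algebra_simps)
    qed
    then have "sublinear_lower p v (x + y) - sublinear_lower p v x \<le> sublinear_lower p v y"
      by (intro ge) (simp add: algebra_simps)
    then show "sublinear_lower p v (x + y) \<le> sublinear_lower p v x + sublinear_lower p v y"
      by simp
  next
    show "sublinear_lower p v 0 = 0"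
      using le[of 0 0] ge[of 0 0] by (simp add: sublinear_zero[OF p] sublinear_scale[OF p])
  next
    fix a :: real and x assume a: "a > 0"
    have "inverse a * sublinear_lower p v (a *\<^sub>R x) \<le> sublinear_lower p v x"
    proof (rule ge)
      fix t :: real assume t: "t \<ge> 0"
      have "sublinear_lower p v (a *\<^sub>R x) \<le> p (a *\<^sub>R x + (a * t) *\<^sub>R v) - (a * t) * p v"
        using a t by (intro le) simp
      also have "a *\<^sub>R x + (a * t) *\<^sub>R v = a *\<^sub>R (x + t *\<^sub>R v)"
        by (simp add: algebra_simps)
      also have "p \<dots> = a * p (x + t *\<^sub>R v)"
        using a by (intro sublinear_scale[OF p]) simp
      finally show "inverse a * sublinear_lower p v (a *\<^sub>R x) \<le> p (x + t *\<^sub>R v) - t * p v"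
        using a by (simp add: field_simps)
    qed
    then show "sublinear_lower p v (a *\<^sub>R x) \<le> a * sublinear_lower p v x"
      using a by (simp add: field_simps)
  qed
qed

text \<open>The common bound \<open>- p (- x)\<close> makes the infimum finite. Subadditivity uses
  the chain condition: of two members \<open>q\<close> and \<open>r\<close>, the smaller one lies
  below both, so its own subadditivity can be applied.\<close>

lemma sublinear_INF_chain:
  assumes C: "C \<noteq> {}" "\<And>q. q \<in> C \<Longrightarrow> sublinear q \<and> q \<le> p"
    and chain: "\<And>q r. q \<in> C \<Longrightarrow> r \<in> C \<Longrightarrow> q \<le> r \<or> r \<le> q"
  shows "sublinear (\<lambda>x. INF q\<in>C. q x)" (is "sublinear ?u")
    and "q \<in> C \<Longrightarrow> (INF q\<in>C. q x) \<le> q x"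
proof -
  have "- p (- x) \<le> q x" if "q \<in> C" for q x
    using C(2)[OF that] sublinear_minus[of q x] le_funD[of q p "- x"] by linarith
  then have bdd: "bdd_below ((\<lambda>q. q x) ` C)" for x
    by (intro bdd_belowI2[where m="- p (- x)"]) auto
  show le: "?u x \<le> q x" if "q \<in> C" for q x
    using that bdd by (intro cINF_lower) auto
  have ge: "m \<le> ?u x" if "\<And>q. q \<in> C \<Longrightarrow> m \<le> q x" for m x
    using that C(1) by (intro cINF_greatest) auto
  show "sublinear ?u"
  proof (rule sublinearI)
    fix x y
    have "?u (x + y) - r y \<le> ?u x" if r: "r \<in> C" for r
    proof (rule ge)
      fix q assume q: "q \<in> C"
      obtain w where w: "w \<in> C" "w \<le> q" "w \<le> r"
        using chain[OF q r] q r by auto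
      have "?u (x + y) \<le> w x + w y"
        using le[OF w(1), of "x + y"] sublinear_add[of w x y] C(2)[OF w(1)] by linarith
      then show "?u (x + y) - r y \<le> q x"
        using le_funD[OF w(2), of x] le_funD[OF w(3), of y] by linarith
    qed
    then have "?u (x + y) - ?u x \<le> ?u y"
      by (intro ge) (simp add: algebra_simps)
    then show "?u (x + y) \<le> ?u x + ?u y" by simp
  next
    show "?u 0 = 0"
      using C by (simp add: sublinear_zero)
  next
    fix a :: real and x assume a: "a > 0"
    have "inverse a * ?u (a *\<^sub>R x) \<le> ?u x"
    proof (rule ge)
      fix q assume q: "q \<in> C"
      show "inverse a * ?u (a *\<^sub>R x) \<le> q x"
        using le[OF q, of "a *\<^sub>R x"] a sublinear_scale[of q a x] C(2)[OF q]
        by (simp add: field_simps)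
    qed
    then show "?u (a *\<^sub>R x) \<le> a * ?u x"
      using a by (simp add: field_simps)
  qed
qed

text \<open>Zorn's lemma for the reversed order: a nonempty chain is bounded by its pointwise
  infimum, the empty one by \<open>p\<close> itself.\<close>

lemma minimal_sublinear_exists:
  assumes p: "sublinear p"
  obtains q where "sublinear q" "q \<le> p" "\<And>r. sublinear r \<Longrightarrow> r \<le> q \<Longrightarrow> r = q"
proof -
  let ?A = "{q. sublinear q \<and> q \<le> p}"
  have "\<exists>m\<in>?A. \<forall>a\<in>?A. m \<ge> a \<longrightarrow> a = m"
  proof (rule predicate_Zorn)
    show "partial_order_on ?A (relation_of (\<ge>) ?A)"
      by (rule partial_order_on_relation_ofI) auto
  next
    fix C assume C: "C \<in> Chains (relation_of (\<ge>) ?A)"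
    then have C': "\<And>q. q \<in> C \<Longrightarrow> sublinear q \<and> q \<le> p"
      "\<And>q r. q \<in> C \<Longrightarrow> r \<in> C \<Longrightarrow> q \<le> r \<or> r \<le> q"
      unfolding Chains_def relation_of_def by blast+
    show "\<exists>u\<in>?A. \<forall>a\<in>C. a \<ge> u"
    proof (cases "C = {}")
      case True
      with p show ?thesis by auto
    next
      case False
      note u = sublinear_INF_chain[OF False C']
      obtain q where "q \<in> C" using False by blast
      then have "(\<lambda>x. INF q\<in>C. q x) \<le> q"
        using u(2) by (simp add: le_fun_def)
      also have "q \<le> p" using C'(1) \<open>q \<in> C\<close> by simp
      finally have "(\<lambda>x. INF q\<in>C. q x) \<in> ?A"
        using u(1) by simp
      moreover have "\<forall>a\<in>C. (\<lambda>x. INF q\<in>C. q x) \<le> a"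
        using u(2) by (simp add: le_fun_def)
      ultimately show ?thesis by blast
    qed
  qed
  then show thesis
    using that by (auto intro: order_trans)
qed

text \<open>A minimal sublinear functional \<open>q\<close> coincides with each \<open>sublinear_lower q v\<close>, whose value
  at \<open>- v\<close> is at most \<open>- q v\<close>; so \<open>q\<close> is odd and hence linear. Starting Zorn's lemma
  from \<open>sublinear_lower p v\<close> instead of \<open>p\<close> forces equality with \<open>p\<close> at \<open>v\<close>.\<close>

lemma hahn_banach_sublinear:
  fixes p :: "'a::real_vector \<Rightarrow> real"
  assumes p: "sublinear p"
  obtains f where "linear f" "\<And>x. f x \<le> p x" "f v = p v"
proof -
  have lower: "sublinear_lower r w \<le> r" "sublinear_lower r w (- w) \<le> - r w"
    if "sublinear r" for r :: "'a \<Rightarrow> real" and w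
    using sublinear_lower_le[OF that, of 0 w] sublinear_lower_le[OF that, of 1 w "- w"]
    by (auto simp: le_fun_def sublinear_zero[OF that])
  obtain f where f: "sublinear f" "f \<le> sublinear_lower p v"
    and min: "\<And>r. sublinear r \<Longrightarrow> r \<le> f \<Longrightarrow> r = f"
    using minimal_sublinear_exists[OF sublinear_sublinear_lower[OF p]] by blast
  have minus: "f (- x) = - f x" for x
    using lower(2)[OF f(1), of x] min[OF sublinear_sublinear_lower[OF f(1)] lower(1)[OF f(1)]]
      sublinear_minus[OF f(1), of x] by (metis add.inverse_inverse le_minus_iff order_antisym)
  have "linear f"
  proof (rule linearI)
    fix x y
    show "f (x + y) = f x + f y"
      using sublinear_add[OF f(1), of x y] sublinear_add[OF f(1), of "- x" "- y"]
        minus[of "x + y"] by (simp add: minus)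
  next
    fix a x
    show "f (a *\<^sub>R x) = a *\<^sub>R f x"
      using sublinear_scale[OF f(1), of a x] sublinear_scale[OF f(1), of "- a" x]
        minus[of "a *\<^sub>R x"] by (cases "a \<ge> 0") auto
  qed
  moreover have le: "f x \<le> p x" for x
    using le_funD[OF f(2), of x] le_funD[OF lower(1)[OF p, of v], of x] by linarith
  moreover have "f v = p v"
    using le[of v] le_funD[OF f(2), of "- v"] lower(2)[OF p, of v] minus[of v] by linarith
  ultimately show thesis by (rule that)
qed

section \<open>Separating a point from a closed subspace\<close>

lemma subspace_closure:
  fixes V :: "'a::real_normed_vector set"
  assumes V: "subspace V"
  shows "subspace (closure V)"
proof (rule subspaceI)
  show "0 \<in> closure V"
    using subspace_0[OF V] closure_subset by blast
  show "x + y \<in> closure V" if "x \<in> closure V" "y \<in> closure V" for x y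
  proof -
    from that(1) obtain u where "\<forall>n. u n \<in> V" "u \<longlonglongrightarrow> x"
      unfolding closure_sequential by auto
    moreover from that(2) obtain w where "\<forall>n. w n \<in> V" "w \<longlonglongrightarrow> y"
      unfolding closure_sequential by auto
    ultimately show ?thesis
      unfolding closure_sequential
      by (intro exI[of _ "\<lambda>n. u n + w n"]) (auto intro: subspace_add[OF V] tendsto_add)
  qed
  show "c *\<^sub>R x \<in> closure V" if "x \<in> closure V" for c x
  proof -
    from that obtain u where "\<forall>n. u n \<in> V" "u \<longlonglongrightarrow> x"
      unfolding closure_sequential by auto
    then show ?thesis
      unfolding closure_sequential
      by (intro exI[of _ "\<lambda>n. c *\<^sub>R u n"]) (auto intro: subspace_scale[OF V] tendsto_intros)
  qed
qed

text \<open>The distance to \<open>V\<close> is the quotient seminorm. A linear functional below it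
  vanishes on \<open>V\<close> and is bounded by the norm, so it serves as the dominating functional
  for the separation.\<close>

lemma sublinear_infdist:
  fixes V :: "'a::real_normed_vector set"
  assumes V: "subspace V"
  shows "sublinear (\<lambda>x. infdist x V)"
proof (rule sublinearI)
  have ne: "V \<noteq> {}"
    using subspace_0[OF V] by blast
  have ge: "m \<le> infdist x V" if "\<And>v. v \<in> V \<Longrightarrow> m \<le> dist x v" for m x
    unfolding infdist_notempty[OF ne] using ne that by (intro cINF_greatest) auto
  show "infdist 0 V = 0"
    using subspace_0[OF V] by simp
  show "infdist (x + y) V \<le> infdist x V + infdist y V" for x y
  proof -
    have "infdist (x + y) V - dist y w \<le> infdist x V" if w: "w \<in> V" for w
    proof (rule ge)
      fix v assume v: "v \<in> V"
      have "infdist (x + y) V \<le> dist (x + y) (v + w)"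
        using V v w by (intro infdist_le subspace_add)
      also have "\<dots> \<le> dist x v + dist y w"
        by (rule dist_triangle_add)
      finally show "infdist (x + y) V - dist y w \<le> dist x v" by simp
    qed
    then have "infdist (x + y) V - infdist x V \<le> infdist y V"
      by (intro ge) (simp add: algebra_simps)
    then show ?thesis by simp
  qed
  show "infdist (a *\<^sub>R x) V \<le> a * infdist x V" if a: "a > 0" for a x
  proof -
    have "inverse a * infdist (a *\<^sub>R x) V \<le> infdist x V"
    proof (rule ge)
      fix v assume v: "v \<in> V"
      have "infdist (a *\<^sub>R x) V \<le> dist (a *\<^sub>R x) (a *\<^sub>R v)"
        using V v by (intro infdist_le subspace_scale)
      also have "\<dots> = a * dist x v"
        using a by (simp add: dist_norm flip: scaleR_diff_right)
      finally show "inverse a * infdist (a *\<^sub>R x) V \<le> dist x v"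
        using a by (simp add: field_simps)
    qed
    then show ?thesis using a by (simp add: field_simps)
  qed
qed

lemma hahn_banach_closed_subspace:
  fixes V :: "'a::real_normed_vector set"
  assumes V: "subspace V" "closed V" and v: "v \<notin> V"
  obtains f :: "'a \<Rightarrow>\<^sub>L real" where "\<And>x. x \<in> V \<Longrightarrow> f x = 0" "f v \<noteq> 0"
proof -
  obtain f where f: "linear f" "\<And>x. f x \<le> infdist x V" "f v = infdist v V"
    using hahn_banach_sublinear[OF sublinear_infdist[OF V(1)]] by blast
  have minus: "f (- x) = - f x" for x
    using linear_neg[OF f(1)] .
  have "infdist x V \<le> norm x" for x
    using infdist_le[OF subspace_0[OF V(1)], of x] by simp
  then have "\<bar>f x\<bar> \<le> norm x" for x
    using f(2)[of x] f(2)[of "- x"] minus[of x] by (smt (verit) norm_minus_cancel)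
  then have bl: "bounded_linear f"
    using f(1) by (intro bounded_linear_intro[where K=1]) (auto simp: linear_add linear_scale)
  have "f x = 0" if "x \<in> V" for x
    using f(2)[of x] f(2)[of "- x"] minus[of x] that V(1) by (simp add: subspace_neg)
  \<comment> \<open>Here closedness of \<open>V\<close> enters: it makes the distance of
    \<open>v\<close> to \<open>V\<close>, which is the value of \<open>f\<close> at
    \<open>v\<close>, positive.\<close>
  moreover have "f v \<noteq> 0"
    using infdist_pos_not_in_closed[OF V(2) _ v] subspace_0[OF V(1)] f(3) by fastforce
  ultimately show thesis
    using that[of "Blinfun f"] bl by (simp add: bounded_linear_Blinfun_apply)
qed

section \<open>The covariance operator\<close>

context abstract_wiener_space
begin

lemma prob_space_\<gamma>: "prob_space \<gamma>"
  and sets_\<gamma> [measurable_cong]: "sets \<gamma> = sets borel"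
  using gaussian by (simp_all add: radon_gaussian_measure_def)

lemma space_\<gamma> [simp]: "space \<gamma> = UNIV"
  using sets_eq_imp_space_eq[OF sets_\<gamma>] by simp

lemma borel_measurable_dual [measurable]:
  "blinfun_apply (f :: 'a \<Rightarrow>\<^sub>L real) \<in> borel_measurable \<gamma>"
  by (subst measurable_cong_sets[OF sets_\<gamma> refl])
    (intro borel_measurable_continuous_onI continuous_intros)

text \<open>The law of \<open>f\<close> is a point mass or a normal distribution; both have a second
  moment, which is pulled back to the Gaussian measure.\<close>

lemma integrable_dual_square:
  fixes f :: "'a \<Rightarrow>\<^sub>L real"
  shows "integrable \<gamma> (\<lambda>x. (blinfun_apply f x)\<^sup>2)"
proof -
  obtain m \<sigma> where \<sigma>: "\<sigma> \<ge> 0" and d: "distr \<gamma> borel (blinfun_apply f) =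
      (if \<sigma> = 0 then return borel m else density lborel (normal_density m \<sigma>))"
    using gaussian unfolding radon_gaussian_measure_def by blast
  have "integrable (distr \<gamma> borel (blinfun_apply f)) (\<lambda>t. t\<^sup>2)"
  proof (cases "\<sigma> = 0")
    case True
    interpret prob_space "return borel m :: real measure"
      by (rule prob_space_return) simp
    have "AE t in return borel m. t\<^sup>2 = m\<^sup>2"
      by (subst AE_return) auto
    moreover have "integrable (return borel m) (\<lambda>_. m\<^sup>2)" by simp
    ultimately have "integrable (return borel m) (\<lambda>t. t\<^sup>2)"
      by (subst integrable_cong_AE[where g="\<lambda>_. m\<^sup>2"]) auto
    with True d show ?thesis by simp
  next
    case False
    with \<sigma> have \<sigma>: "\<sigma> > 0" by simp
    \<comment> \<open>The square of \<open>t\<close> is expanded around the mean \<open>m\<close>,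
      because integrability is available for central moments.\<close>
    have "integrable lborel (\<lambda>t. normal_density m \<sigma> t * (t - m)^2
        + 2 * m * (normal_density m \<sigma> t * (t - m)^1) + m\<^sup>2 * normal_density m \<sigma> t)"
      by (intro Bochner_Integration.integrable_add integrable_mult_right
          integrable_normal_moment[OF \<sigma>] integrable_normal_density[OF \<sigma>])
    also have "(\<lambda>t. normal_density m \<sigma> t * (t - m)^2
        + 2 * m * (normal_density m \<sigma> t * (t - m)^1) + m\<^sup>2 * normal_density m \<sigma> t) =
        (\<lambda>t. normal_density m \<sigma> t * t\<^sup>2)"
      by (auto simp: power2_eq_square algebra_simps)
    finally have "integrable (density lborel (normal_density m \<sigma>)) (\<lambda>t. t\<^sup>2)"
      by (subst integrable_density) (auto simp: mult.commute)
    with False d show ?thesis by simp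
  qed
  then show ?thesis
    by (subst (asm) integrable_distr_eq) auto
qed

lemma integrable_mult_of_squares:
  assumes [measurable]: "u \<in> borel_measurable \<gamma>" "v \<in> borel_measurable \<gamma>"
    and "integrable \<gamma> (\<lambda>x. (u x)\<^sup>2)" "integrable \<gamma> (\<lambda>x. (v x)\<^sup>2)"
  shows "integrable \<gamma> (\<lambda>x. u x * v x :: real)"
proof (rule Bochner_Integration.integrable_bound)
  show "integrable \<gamma> (\<lambda>x. (u x)\<^sup>2 + (v x)\<^sup>2)"
    using assms by simp
  have "\<bar>u x * v x\<bar> \<le> (u x)\<^sup>2 + (v x)\<^sup>2" for x
    using sum_squares_bound[of "u x" "v x"] sum_squares_bound[of "u x" "- v x"]
      zero_le_power2[of "u x"] zero_le_power2[of "v x"]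
    unfolding abs_le_iff by (simp only: power2_minus mult_minus_right mult.assoc) linarith
  then show "AE x in \<gamma>. norm (u x * v x) \<le> norm ((u x)\<^sup>2 + (v x)\<^sup>2)"
    by simp
qed simp

lemma covariance_apply: "blinfun_apply g (Q f) = (\<integral>x. f x * g x \<partial>\<gamma>)"
  using covariance by (simp add: covariance_operator_def)

lemma covariance_commute: "blinfun_apply g (Q f) = blinfun_apply f (Q g)"
  by (simp only: covariance_apply mult.commute)

lemma covariance_nonneg: "blinfun_apply f (Q f) \<ge> 0"
  by (simp add: covariance_apply)

text \<open>Zero variance makes \<open>f\<close> vanish almost everywhere. Its kernel is then a
  closed subspace of full measure, hence the whole space by nondegeneracy.\<close>

lemma covariance_eq_0D:
  assumes "blinfun_apply f (Q f) = 0"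
  shows "f = 0"
proof -
  interpret prob_space \<gamma> by (rule prob_space_\<gamma>)
  let ?V = "{x. blinfun_apply f x = 0}"
  have "(\<integral>x. (blinfun_apply f x)\<^sup>2 \<partial>\<gamma>) = 0"
    using assms by (simp add: covariance_apply power2_eq_square)
  then have "AE x in \<gamma>. (blinfun_apply f x)\<^sup>2 = 0"
    using integral_nonneg_eq_0_iff_AE[OF integrable_dual_square[of f]] by simp
  then have AE: "AE x in \<gamma>. x \<in> ?V" by simp
  have closed: "closed ?V"
    by (intro closed_Collect_eq continuous_intros)
  then have "?V \<in> sets \<gamma>"
    by (simp add: sets_\<gamma>)
  from emeasure_eq_1_AE[OF this AE] have "emeasure \<gamma> ?V = 1" .
  moreover have "subspace ?V"
    by (auto simp: subspace_def blinfun.add_right blinfun.scaleR_right)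
  moreover note closed
  ultimately have "?V = UNIV"
    using nondegenerate unfolding nondegenerate_measure_def by blast
  then show ?thesis
    by (intro blinfun_eqI) auto
qed

lemma inj_Q: "inj (blinfun_apply Q)"
proof (rule injI)
  fix f g assume "Q f = Q g"
  then have "(f - g) (Q (f - g)) = 0"
    by (simp add: blinfun.diff_right)
  from covariance_eq_0D[OF this] show "f = g" by simp
qed

lemma hat_Q [simp]: "hat Q (Q f) = f"
  unfolding hat_def using inj_Q by (auto simp: inj_def)

section \<open>The Cameron-Martin inner product on the range of \<open>Q\<close>\<close>

lemma dual_in_dual_L2_closure: "blinfun_apply f \<in> dual_L2_closure \<gamma>"
  unfolding dual_L2_closure_def
  using integrable_dual_square[of f] by (auto intro!: exI[of _ f])

lemma cm_represents_Q: "cm_represents \<gamma> (blinfun_apply f) (Q f)"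
  by (simp add: cm_represents_def dual_in_dual_L2_closure covariance_apply)

lemma range_Q_subset_cm_space: "range (blinfun_apply Q) \<subseteq> cm_space \<gamma>"
  using cm_represents_Q by (auto simp: cm_space_def)

text \<open>The difference \<open>u\<close> of \<open>s\<close> and \<open>f\<close> is orthogonal
  to every functional. For a functional \<open>g\<close> close to \<open>s\<close>, Pythagoras
  splits the squared distance of \<open>s\<close> and \<open>g\<close> into those of
  \<open>u\<close> and \<open>g - f\<close> from 0, so \<open>u\<close> is arbitrarily small in mean
  square.\<close>

lemma cm_represents_Q_unique:
  assumes s: "cm_represents \<gamma> s (Q f)"
  shows "AE x in \<gamma>. s x = f x"
proof -
  have [measurable]: "s \<in> borel_measurable \<gamma>" and s2: "integrable \<gamma> (\<lambda>x. (s x)\<^sup>2)"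
    and approx: "\<And>\<epsilon>. \<epsilon> > 0 \<Longrightarrow> \<exists>g :: 'a \<Rightarrow>\<^sub>L real. (\<integral>x. (s x - g x)\<^sup>2 \<partial>\<gamma>) < \<epsilon>"
    and sg: "\<And>g :: 'a \<Rightarrow>\<^sub>L real. g (Q f) = (\<integral>x. s x * g x \<partial>\<gamma>)"
    using s by (auto simp: cm_represents_def dual_L2_closure_def)
  define u where "u x = s x - f x" for x
  have [measurable]: "u \<in> borel_measurable \<gamma>"
    unfolding u_def by measurable
  have i_sg: "integrable \<gamma> (\<lambda>x. s x * g x)" and i_fg: "integrable \<gamma> (\<lambda>x. f x * g x)"
    for g :: "'a \<Rightarrow>\<^sub>L real"
    by (intro integrable_mult_of_squares; simp add: s2 integrable_dual_square)+
  have "integrable \<gamma> (\<lambda>x. (s x)\<^sup>2 - 2 * (s x * f x) + (f x)\<^sup>2)"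
    using s2 i_sg integrable_dual_square by simp
  then have u2: "integrable \<gamma> (\<lambda>x. (u x)\<^sup>2)"
    by (rule Bochner_Integration.integrable_cong[THEN iffD1, rotated 2])
      (auto simp: u_def power2_eq_square algebra_simps)
  have i_ug: "integrable \<gamma> (\<lambda>x. u x * g x)" for g :: "'a \<Rightarrow>\<^sub>L real"
    by (intro integrable_mult_of_squares) (simp_all add: u2 integrable_dual_square)
  have ug: "(\<integral>x. u x * g x \<partial>\<gamma>) = 0" for g :: "'a \<Rightarrow>\<^sub>L real"
    using sg[of g] i_sg[of g] i_fg[of g] by (simp add: u_def left_diff_distrib covariance_apply)
  have "(\<integral>x. (u x)\<^sup>2 \<partial>\<gamma>) < \<epsilon>" if "\<epsilon> > 0" for \<epsilon>
  proof -
    from approx[OF that] obtain g :: "'a \<Rightarrow>\<^sub>L real" where g: "(\<integral>x. (s x - g x)\<^sup>2 \<partial>\<gamma>) < \<epsilon>"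
      by blast
    let ?v = "g - f"
    have "(\<integral>x. (s x - g x)\<^sup>2 \<partial>\<gamma>) = (\<integral>x. (u x)\<^sup>2 - 2 * (u x * ?v x) + (?v x)\<^sup>2 \<partial>\<gamma>)"
      by (intro Bochner_Integration.integral_cong)
        (auto simp: u_def power2_eq_square algebra_simps blinfun.diff_left)
    also have "\<dots> = (\<integral>x. (u x)\<^sup>2 \<partial>\<gamma>) + (\<integral>x. (?v x)\<^sup>2 \<partial>\<gamma>)"
      using u2 i_ug[of ?v] ug[of ?v] integrable_dual_square[of ?v] by simp
    finally show ?thesis
      using g by (smt (verit) Bochner_Integration.integral_nonneg zero_le_power2)
  qed
  \<comment> \<open>A positive value of this integral would be an admissible bound, hence smaller
    than itself.\<close>
  from this[of "\<integral>x. (u x)\<^sup>2 \<partial>\<gamma>"] have "(\<integral>x. (u x)\<^sup>2 \<partial>\<gamma>) = 0"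
    using Bochner_Integration.integral_nonneg[of \<gamma> "\<lambda>x. (u x)\<^sup>2"] by fastforce
  then have "AE x in \<gamma>. (u x)\<^sup>2 = 0"
    using u2 by (subst (asm) integral_nonneg_eq_0_iff_AE) auto
  then show ?thesis
    by (simp add: u_def)
qed

text \<open>The representatives chosen in \<open>cm_inner\<close> agree almost everywhere with
  \<open>f\<close> and \<open>g\<close>, so the abstract inner product becomes a mere
  evaluation.\<close>

lemma cm_inner_Q: "cm_inner \<gamma> (Q f) (Q g) = blinfun_apply f (Q g)"
proof -
  define s where "s f = (SOME s. cm_represents \<gamma> s (Q f))" for f
  have s: "cm_represents \<gamma> (s f) (Q f)" for f
    unfolding s_def using cm_represents_Q[of f] by (rule someI[where P="\<lambda>s. cm_represents \<gamma> s (Q f)"])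
  then have [measurable]: "s f \<in> borel_measurable \<gamma>" for f
    by (simp add: cm_represents_def dual_L2_closure_def)
  have "cm_inner \<gamma> (Q f) (Q g) = (\<integral>x. s f x * s g x \<partial>\<gamma>)"
    by (simp add: cm_inner_def s_def)
  also have "\<dots> = (\<integral>x. f x * g x \<partial>\<gamma>)"
    using cm_represents_Q_unique[OF s[of f]] cm_represents_Q_unique[OF s[of g]]
    by (intro integral_cong_AE) auto
  finally show ?thesis
    using covariance_apply[of g f] covariance_commute[of g f] by simp
qed

lemma subspace_range_Q: "subspace (range (blinfun_apply Q))"
  by (metis bounded_linear.linear blinfun.bounded_linear_right linear_subspace_image subspace_UNIV)

lemma cm_inner_hat: "h \<in> range Q \<Longrightarrow> k \<in> range Q \<Longrightarrow> cm_inner \<gamma> h k = hat Q h k"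
  by (auto simp: cm_inner_Q)

lemma hat_commute: "h \<in> range Q \<Longrightarrow> k \<in> range Q \<Longrightarrow> hat Q h k = hat Q k h"
  by (auto simp: covariance_commute)

lemma hat_pos: "h \<in> range Q \<Longrightarrow> h \<noteq> 0 \<Longrightarrow> hat Q h h > 0"
  using covariance_nonneg covariance_eq_0D by (force simp: less_le)

text \<open>Gram-Schmidt: \<open>b\<close> is the component of the new vector \<open>a\<close>
  orthogonal to the old basis. It is normalised and added, unless it is 0 and the old basis already
  spans \<open>a\<close>.\<close>

lemma cm_orthonormal_basis_exists:
  assumes "finite A" "A \<subseteq> range Q"
  shows "\<exists>B. cm_orthonormal_basis \<gamma> (span A) B"
  using assms
proof (induction A rule: finite_induct)
  case empty
  have "cm_orthonormal_basis \<gamma> (span {}) {}"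
    by (simp add: cm_orthonormal_basis_def)
  then show ?case by blast
next
  case (insert a A)
  then obtain B where B: "finite B" "span B = span A"
    and ON: "\<And>h k. h \<in> B \<Longrightarrow> k \<in> B \<Longrightarrow> cm_inner \<gamma> h k = (if h = k then 1 else 0)"
    by (auto simp: cm_orthonormal_basis_def)
  have "span A \<subseteq> range Q"
    using insert by (intro span_minimal subspace_range_Q) auto
  then have BQ: "B \<subseteq> range Q"
    using B(2) span_superset[of B] by auto
  define p where "p = (\<Sum>h\<in>B. hat Q h a *\<^sub>R h)"
  define b where "b = a - p"
  have p: "p \<in> span B"
    unfolding p_def by (intro span_sum span_scale span_base)
  have a: "a \<in> range Q" using insert by simp
  have b: "b \<in> range Q"
    unfolding b_def using p B(2) \<open>span A \<subseteq> range Q\<close> a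
    by (intro subspace_diff[OF subspace_range_Q]) auto
  have orth: "hat Q h b = 0" if "h \<in> B" for h
  proof -
    have "hat Q h p = (\<Sum>k\<in>B. hat Q k a * cm_inner \<gamma> h k)"
      using that BQ
      by (auto simp: p_def blinfun.sum_right blinfun.scaleR_right cm_inner_hat subset_eq
          intro!: sum.cong)
    also have "\<dots> = (\<Sum>k\<in>B. if h = k then hat Q k a else 0)"
      using that by (intro sum.cong) (auto simp: ON)
    finally show ?thesis
      using B(1) that by (simp add: b_def blinfun.diff_right)
  qed
  have span: "span (insert a A) = span (insert b B)"
  proof -
    have "span (insert a A) = span (insert a B)"
      by (simp only: span_insert B(2))
    also have "\<dots> = span (insert b B)"
      by (rule eq_span_insert_eq) (simp add: b_def p)
    finally show ?thesis .
  qed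
  show ?case
  proof (cases "b = 0")
    case True
    then have "cm_orthonormal_basis \<gamma> (span (insert a A)) B"
      unfolding span using B ON by (auto simp: cm_orthonormal_basis_def)
    then show ?thesis by blast
  next
    case False
    define c where "c = b /\<^sub>R sqrt (hat Q b b)"
    have pos: "hat Q b b > 0" using hat_pos[OF b False] .
    have c: "c \<in> range Q"
      unfolding c_def by (intro subspace_scale[OF subspace_range_Q] b)
    have hat_c: "hat Q c = hat Q b /\<^sub>R sqrt (hat Q b b)"
      using b by (auto simp: c_def simp flip: blinfun.scaleR_right)
    have cc: "cm_inner \<gamma> c c = 1"
      using pos by (simp add: cm_inner_hat c hat_c)
        (simp add: c_def blinfun.scaleR_right blinfun.scaleR_left field_simps)
    have hc: "cm_inner \<gamma> h c = 0" "cm_inner \<gamma> c h = 0" if "h \<in> B" for h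
    proof -
      have h: "h \<in> range Q" using that BQ by blast
      have "hat Q h c = 0"
        using orth[OF that] by (simp add: c_def blinfun.scaleR_right)
      then show "cm_inner \<gamma> h c = 0" "cm_inner \<gamma> c h = 0"
        using h c hat_commute[OF h c] by (simp_all add: cm_inner_hat)
    qed
    have "b = sqrt (hat Q b b) *\<^sub>R c"
      using pos by (simp add: c_def)
    then have "b \<in> span (insert c B)"
      by (metis insertI1 span_base span_scale)
    moreover have "c \<in> span (insert b B)"
      unfolding c_def by (intro span_scale span_base) simp
    ultimately have "span (insert c B) = span (insert b B)"
      by (auto simp: span_eq intro: span_base)
    moreover have "c \<notin> B"
      using hc(1)[of c] cc by auto
    ultimately have "cm_orthonormal_basis \<gamma> (span (insert a A)) (insert c B)"
      unfolding span cm_orthonormal_basis_def using B(1) ON cc hc by auto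
    then show ?thesis by blast
  qed
qed

text \<open>Otherwise Hahn-Banach gives a nonzero \<open>f\<close> vanishing on \<open>D\<close>.
  Then \<open>Q f\<close> is orthogonal to \<open>D\<close>, so no point of \<open>D\<close> is
  closer to it than its own Cameron-Martin norm, and density forces that norm to be 0.\<close>

lemma cm_dense_imp_dense:
  assumes D: "subspace D" "D \<subseteq> range Q" "cm_dense \<gamma> D"
  shows "closure D = UNIV"
proof (rule ccontr)
  assume "closure D \<noteq> UNIV"
  then obtain v where "v \<notin> closure D" by blast
  then obtain f :: "'a \<Rightarrow>\<^sub>L real" where f: "\<And>x. x \<in> closure D \<Longrightarrow> f x = 0" "f v \<noteq> 0"
    using hahn_banach_closed_subspace[OF subspace_closure[OF D(1)] closed_closure] by metis
  have "f (Q f) < \<epsilon>\<^sup>2" if \<epsilon>: "\<epsilon> > 0" for \<epsilon>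
  proof -
    have "Q f \<in> cm_space \<gamma>"
      using range_Q_subset_cm_space by auto
    then obtain d where d: "d \<in> D" "cm_norm \<gamma> (Q f - d) < \<epsilon>"
      using D(3) \<epsilon> unfolding cm_dense_def by blast
    then obtain g where g: "d = Q g"
      using D(2) by blast
    \<comment> \<open>The first holds because \<open>d\<close> lies in \<open>D\<close>, the second
      by symmetry of the covariance. They are the cross terms in the square of
      \<open>f - g\<close>.\<close>
    have "f (Q g) = 0" "g (Q f) = 0"
      using d(1) f(1)[of d] closure_subset[of D] g covariance_commute[of f g] by auto
    then have "(f - g) (Q (f - g)) = f (Q f) + g (Q g)"
      by (simp add: blinfun.diff_left blinfun.diff_right)
    moreover have "sqrt ((f - g) (Q (f - g))) < \<epsilon>"
    proof -
      have "Q f - d = Q (f - g)"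
        by (simp add: g blinfun.diff_right)
      with d(2) show ?thesis
        by (simp add: cm_norm_def cm_inner_Q)
    qed
    then have "(f - g) (Q (f - g)) < \<epsilon>\<^sup>2"
      using \<epsilon> covariance_nonneg[of "f - g"] by (metis less_eq_real_def real_sqrt_pow2 power_strict_mono pos2 real_sqrt_ge_zero)
    ultimately show ?thesis
      using covariance_nonneg[of g] by simp
  qed
  from this[of "sqrt (f (Q f))"] have "f (Q f) = 0"
    using covariance_nonneg[of f] by (cases "f (Q f) = 0") auto
  then have "f = 0" by (rule covariance_eq_0D)
  with f(2) show False by simp
qed

end

section \<open>Lebesgue density in finite-dimensional subspaces\<close>

text \<open>Within the range of \<open>Q\<close> the inner product is evaluation of
  \<open>hat\<close>, so the functionals \<open>hat Q h\<close> for basis vectors \<open>h\<close>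
  are Euclidean coordinates on \<open>F\<close>.\<close>

locale cm_subspace = abstract_wiener_space \<gamma> Q
  for \<gamma> :: "'a::{banach, second_countable_topology} measure"
    and Q :: "('a \<Rightarrow>\<^sub>L real) \<Rightarrow>\<^sub>L 'a" +
  fixes F :: "'a set"
  assumes finite_dim: "\<exists>A. finite A \<and> span A = F"
    and F_subset: "F \<subseteq> range (blinfun_apply Q)"
begin

abbreviation B where "B \<equiv> cm_basis \<gamma> F"

lemma subspace_F: "subspace F"
  using finite_dim by auto

lemma cm_orthonormal_basis_B: "cm_orthonormal_basis \<gamma> F B"
proof -
  obtain A where A: "finite A" "span A = F"
    using finite_dim by blast
  then have "A \<subseteq> range (blinfun_apply Q)"
    using F_subset span_superset[of A] by blast
  with A have "\<exists>B. cm_orthonormal_basis \<gamma> F B"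
    using cm_orthonormal_basis_exists by blast
  then show ?thesis
    unfolding cm_basis_def by (rule someI_ex)
qed

lemma finite_B [simp]: "finite B"
  and span_B: "span B = F"
  using cm_orthonormal_basis_B by (auto simp: cm_orthonormal_basis_def)

lemma B_subset: "B \<subseteq> F"
  using span_B span_superset by blast

lemma hat_basis:
  assumes "h \<in> B" "k \<in> B"
  shows "hat Q h k = (if h = k then 1 else 0)"
proof -
  have "h \<in> range Q" "k \<in> range Q"
    using assms B_subset F_subset by blast+
  from cm_inner_hat[OF this] show ?thesis
    using assms cm_orthonormal_basis_B by (simp add: cm_orthonormal_basis_def)
qed

lemma hat_sum_basis:
  assumes "h \<in> B"
  shows "hat Q h (\<Sum>k\<in>B. c k *\<^sub>R k) = c h"
proof -
  have "hat Q h (\<Sum>k\<in>B. c k *\<^sub>R k) = (\<Sum>k\<in>B. if h = k then c k else 0)"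
    using assms by (simp add: blinfun.sum_right blinfun.scaleR_right hat_basis if_distrib cong: sum.cong if_cong)
  then show ?thesis using assms by simp
qed

lemma cm_proj_in: "cm_proj \<gamma> Q F x \<in> F"
  unfolding cm_proj_def using B_subset
  by (intro subspace_sum subspace_scale subspace_F) auto

lemma sum_basis_in: "(\<Sum>h\<in>B. c h *\<^sub>R h) \<in> F"
  using B_subset by (intro subspace_sum subspace_scale subspace_F) auto

lemma cm_proj_ident:
  assumes "w \<in> F"
  shows "cm_proj \<gamma> Q F w = w"
proof -
  obtain c where c: "w = (\<Sum>k\<in>B. c k *\<^sub>R k)"
    using assms span_finite[OF finite_B] span_B by auto
  show ?thesis
    unfolding c cm_proj_def by (intro sum.cong refl) (simp add: hat_sum_basis)
qed

lemma cm_proj_diff: "cm_proj \<gamma> Q F (x - y) = cm_proj \<gamma> Q F x - cm_proj \<gamma> Q F y"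
  by (simp add: cm_proj_def blinfun.diff_right scaleR_diff_left sum_subtractf)

text \<open>\<open>F\<close> is the fixed-point set of a continuous projection.\<close>

lemma closed_F: "closed F"
proof -
  have "F = {w. cm_proj \<gamma> Q F w = w}"
    using cm_proj_ident cm_proj_in by (metis (mono_tags, lifting) Collect_cong Collect_mem_eq)
  also have "closed \<dots>"
    unfolding cm_proj_def by (intro closed_Collect_eq continuous_intros)
  finally show ?thesis .
qed

text \<open>Parseval's identity, by expanding one factor of the inner product in the basis.\<close>

lemma cm_norm_eq:
  assumes w: "w \<in> F"
  shows "cm_norm \<gamma> w = L2_set (\<lambda>h. hat Q h w) B"
proof -
  have wQ: "w \<in> range Q" using w F_subset by blast
  have "cm_inner \<gamma> w w = hat Q w (\<Sum>h\<in>B. hat Q h w *\<^sub>R h)"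
    using cm_inner_hat[OF wQ wQ] cm_proj_ident[OF w] by (simp add: cm_proj_def)
  also have "\<dots> = (\<Sum>h\<in>B. hat Q h w * hat Q w h)"
    by (simp add: blinfun.sum_right blinfun.scaleR_right)
  also have "\<dots> = (\<Sum>h\<in>B. (hat Q h w)\<^sup>2)"
  proof (intro sum.cong refl)
    fix h assume "h \<in> B"
    then have "h \<in> range Q" using B_subset F_subset by blast
    from hat_commute[OF this wQ] show "hat Q h w * hat Q w h = (hat Q h w)\<^sup>2"
      by (simp add: power2_eq_square)
  qed
  finally show ?thesis
    by (simp add: cm_norm_def L2_set_def)
qed

lemma abs_hat_le_cm_norm: "w \<in> F \<Longrightarrow> h \<in> B \<Longrightarrow> \<bar>hat Q h w\<bar> \<le> cm_norm \<gamma> w"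
  using member_le_L2_set[of B h "\<lambda>h. \<bar>hat Q h w\<bar>"] by (simp add: cm_norm_eq L2_set_def)

lemma cm_norm_le_sum_abs: "w \<in> F \<Longrightarrow> cm_norm \<gamma> w \<le> (\<Sum>h\<in>B. \<bar>hat Q h w\<bar>)"
  by (simp add: cm_norm_eq L2_set_le_sum_abs)

text \<open>The inclusion of \<open>F\<close> into the Banach space is continuous with an explicit
  constant. This puts small Cameron-Martin balls inside open sets.\<close>

lemma norm_le_cm_norm:
  assumes w: "w \<in> F"
  shows "norm w \<le> (\<Sum>h\<in>B. norm h) * cm_norm \<gamma> w"
proof -
  have "norm w = norm (\<Sum>h\<in>B. hat Q h w *\<^sub>R h)"
    using cm_proj_ident[OF w] by (simp add: cm_proj_def)
  also have "\<dots> \<le> (\<Sum>h\<in>B. norm h * cm_norm \<gamma> w)"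
    using abs_hat_le_cm_norm[OF w]
    by (intro sum_norm_le) (simp add: mult.commute mult_left_mono)
  finally show ?thesis by (simp add: sum_distrib_right)
qed

section \<open>Coordinate cubes and their comparison with balls\<close>

definition cube :: "'a \<Rightarrow> real \<Rightarrow> 'a set" where
  "cube z a = {w \<in> F. \<forall>h\<in>B. \<bar>hat Q h (w - z)\<bar> \<le> a}"

lemma cube_borel [measurable]: "cube z a \<in> sets borel"
proof -
  have "cube z a = F \<inter> (\<Inter>h\<in>B. {w. \<bar>hat Q h (w - z)\<bar> \<le> a})"
    by (auto simp: cube_def)
  moreover have "closed \<dots>"
    by (intro closed_Int closed_F closed_INT ballI closed_Collect_le continuous_intros)
  ultimately show ?thesis by simp
qed

lemma cm_ball_borel [measurable]:
  assumes z: "z \<in> F"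
  shows "cm_ball \<gamma> F z r \<in> sets borel"
proof -
  have "cm_ball \<gamma> F z r = F \<inter> {w. L2_set (\<lambda>h. hat Q h (w - z)) B < r}"
    using z by (auto simp: cm_ball_def cm_norm_eq subspace_diff[OF subspace_F])
  moreover have "open {w. L2_set (\<lambda>h. hat Q h (w - z)) B < r}"
    unfolding L2_set_def by (intro open_Collect_less continuous_intros)
  ultimately show ?thesis
    using closed_F by auto
qed

lemma cm_ball_subset_cube: "z \<in> F \<Longrightarrow> cm_ball \<gamma> F z r \<subseteq> cube z r"
  using abs_hat_le_cm_norm subspace_diff[OF subspace_F]
  by (fastforce simp: cm_ball_def cube_def)

text \<open>The norm is at most the sum of the absolute coordinates. The centres \<open>u\<close>
  and \<open>z\<close> may differ because the cubes that fill a cone are not centred at its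
  vertex.\<close>

lemma cube_subset_cm_ball:
  assumes z: "z \<in> F" and less: "(\<Sum>h\<in>B. \<bar>hat Q h (u - z)\<bar>) + real (card B) * a < r"
  shows "cube u a \<subseteq> cm_ball \<gamma> F z r"
proof
  fix w assume w: "w \<in> cube u a"
  then have wF: "w \<in> F" by (simp add: cube_def)
  have "cm_norm \<gamma> (w - z) \<le> (\<Sum>h\<in>B. \<bar>hat Q h (w - z)\<bar>)"
    using wF z by (intro cm_norm_le_sum_abs subspace_diff[OF subspace_F])
  also have "\<dots> \<le> (\<Sum>h\<in>B. \<bar>hat Q h (u - z)\<bar> + a)"
  proof (rule sum_mono)
    fix h assume "h \<in> B"
    then have "\<bar>hat Q h (w - u)\<bar> \<le> a"
      using w by (simp add: cube_def)
    then show "\<bar>hat Q h (w - z)\<bar> \<le> \<bar>hat Q h (u - z)\<bar> + a"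
      by (simp add: blinfun.diff_right)
  qed
  also have "\<dots> < r"
    using less by (simp add: sum.distrib)
  finally show "w \<in> cm_ball \<gamma> F z r"
    using wF by (simp add: cm_ball_def)
qed

abbreviation vol where "vol \<equiv> lebesgue_on_subspace \<gamma> F"

lemma measurable_sum_basis [measurable]:
  "(\<lambda>c. \<Sum>h\<in>B. c h *\<^sub>R h) \<in> borel_measurable (\<Pi>\<^sub>M h\<in>B. lborel)"
  by measurable

lemma sets_lebesgue_on_subspace: "A \<in> sets borel \<Longrightarrow> A \<in> sets vol"
  by (simp add: lebesgue_on_subspace_def sets_completionI_sets)

text \<open>The coordinate map pulls the cube back to a product of intervals of length
  \<open>2 * a\<close>. The cube is Borel, so the completion does not affect its volume.\<close>

lemma emeasure_cube:
  assumes a: "a \<ge> 0"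
  shows "emeasure vol (cube z a) = ennreal ((2 * a) ^ card B)"
proof -
  interpret product_sigma_finite "\<lambda>_::'a. lborel :: real measure" ..
  have "emeasure vol (cube z a) = emeasure (\<Pi>\<^sub>M h\<in>B. lborel)
      ((\<lambda>c. \<Sum>h\<in>B. c h *\<^sub>R h) -` cube z a \<inter> space (\<Pi>\<^sub>M h\<in>B. lborel))"
    unfolding lebesgue_on_subspace_def
    by (subst emeasure_completion) (simp_all add: emeasure_distr)
  also have "(\<lambda>c. \<Sum>h\<in>B. c h *\<^sub>R h) -` cube z a \<inter> space (\<Pi>\<^sub>M h\<in>B. lborel) =
      (\<Pi>\<^sub>E h\<in>B. {hat Q h z - a .. hat Q h z + a})"
    by (auto simp: cube_def space_PiM PiE_iff sum_basis_in blinfun.diff_right hat_sum_basis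
        abs_le_iff algebra_simps)
  also have "emeasure (\<Pi>\<^sub>M h\<in>B. lborel) \<dots> =
      (\<Prod>h\<in>B. emeasure lborel {hat Q h z - a .. hat Q h z + a})"
    by (rule emeasure_PiM) auto
  also have "\<dots> = ennreal ((2 * a) ^ card B)"
    using a by (simp add: ennreal_power)
  finally show ?thesis .
qed

lemma measure_cube: "a \<ge> 0 \<Longrightarrow> measure vol (cube z a) = (2 * a) ^ card B"
  by (simp add: measure_def emeasure_cube)

lemma fmeasurable_cube: "a \<ge> 0 \<Longrightarrow> cube z a \<in> fmeasurable vol"
  by (intro fmeasurableI sets_lebesgue_on_subspace cube_borel) (simp add: emeasure_cube)

lemma fmeasurable_Int_cm_ball:
  assumes "z \<in> F" "r > 0" "E \<in> sets borel"
  shows "E \<inter> cm_ball \<gamma> F z r \<in> fmeasurable vol"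
proof (rule fmeasurableI2[OF fmeasurable_cube[of r z]])
  show "E \<inter> cm_ball \<gamma> F z r \<subseteq> cube z r"
    using cm_ball_subset_cube[OF assms(1)] by blast
qed (use assms in \<open>auto intro!: sets_lebesgue_on_subspace cm_ball_borel\<close>)

lemma fmeasurable_cm_ball: "z \<in> F \<Longrightarrow> r > 0 \<Longrightarrow> cm_ball \<gamma> F z r \<in> fmeasurable vol"
  using fmeasurable_Int_cm_ball[of z r UNIV] by simp

lemma measure_cm_ball_le: "z \<in> F \<Longrightarrow> r > 0 \<Longrightarrow> measure vol (cm_ball \<gamma> F z r) \<le> (2 * r) ^ card B"
  using measure_mono_fmeasurable[OF cm_ball_subset_cube _ fmeasurable_cube, of z r]
    fmeasurable_cm_ball[of z r] by (simp add: measure_cube fmeasurable_def)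

lemma measure_cm_ball_pos:
  assumes "z \<in> F" "r > 0"
  shows "measure vol (cm_ball \<gamma> F z r) > 0"
proof -
  \<comment> \<open>The added 1 makes \<open>card B * a\<close> strictly smaller than
    \<open>r\<close> and covers dimension 0.\<close>
  define a where "a = r / (card B + 1)"
  have a: "a > 0" using assms by (simp add: a_def)
  have "real (card B) * a < r"
    using assms by (simp add: a_def field_simps)
  then have "cube z a \<subseteq> cm_ball \<gamma> F z r"
    using assms by (intro cube_subset_cm_ball) simp_all
  then have "measure vol (cube z a) \<le> measure vol (cm_ball \<gamma> F z r)"
    using assms by (intro measure_mono_fmeasurable fmeasurable_cm_ball sets_lebesgue_on_subspace) auto
  moreover have "measure vol (cube z a) > 0"
    using a by (simp add: measure_cube)
  ultimately show ?thesis by simp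
qed

lemma eventually_cm_ball_subset:
  assumes z: "z \<in> F" "z \<in> U" and U: "open U"
  shows "\<forall>\<^sub>F r in at_right 0. cm_ball \<gamma> F z r \<subseteq> U"
proof -
  obtain e where e: "e > 0" "ball z e \<subseteq> U"
    using U z by (auto simp: open_contains_ball)
  \<comment> \<open>The added 1 keeps \<open>K\<close> positive even when the basis is
    empty.\<close>
  define K where "K = (\<Sum>h\<in>B. norm h) + 1"
  have K: "K > 0"
    using sum_nonneg[of B norm] by (simp add: K_def)
  have "cm_ball \<gamma> F z r \<subseteq> U" if r: "0 < r" "r < e / K" for r
  proof
    fix w assume w: "w \<in> cm_ball \<gamma> F z r"
    then have "w - z \<in> F"
      using z subspace_diff[OF subspace_F] by (simp add: cm_ball_def)
    then have "norm (w - z) \<le> (\<Sum>h\<in>B. norm h) * cm_norm \<gamma> (w - z)"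
      by (rule norm_le_cm_norm)
    also have "\<dots> \<le> (\<Sum>h\<in>B. norm h) * r"
      using w by (intro mult_left_mono sum_nonneg) (auto simp: cm_ball_def)
    also have "\<dots> \<le> K * r"
      using r by (simp add: K_def)
    also have "\<dots> < e"
      using r K by (simp add: field_simps)
    finally show "w \<in> U"
      using e by (auto simp: dist_norm norm_minus_commute subset_eq)
  qed
  moreover have "\<forall>\<^sub>F r in at_right 0. 0 < r \<and> r < e / K"
    using e K by (auto simp: eventually_at_right_field intro!: exI[of _ "e / K"])
  ultimately show ?thesis
    by (elim eventually_mono) auto
qed

section \<open>Densities at interior points, exterior points and vertices of cones\<close>

lemma has_lebesgue_density_1_interior:
  assumes z: "z \<in> F" "z \<in> U" and U: "open U" "F \<inter> U \<subseteq> E"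
  shows "has_lebesgue_density \<gamma> F E z 1"
  unfolding has_lebesgue_density_def
proof (rule tendsto_eventually)
  have "\<forall>\<^sub>F r in at_right (0::real). r > 0"
    by (simp add: eventually_at_right_less)
  with eventually_cm_ball_subset[OF z U(1)]
  show "\<forall>\<^sub>F r in at_right 0. measure vol (E \<inter> cm_ball \<gamma> F z r) / measure vol (cm_ball \<gamma> F z r) = 1"
  proof eventually_elim
    case (elim r)
    then have "E \<inter> cm_ball \<gamma> F z r = cm_ball \<gamma> F z r"
      using U by (auto simp: cm_ball_def)
    with measure_cm_ball_pos[OF z(1) elim(2)] show ?case by simp
  qed
qed

lemma has_lebesgue_density_0_exterior:
  assumes z: "z \<in> F" "z \<in> U" and U: "open U" "U \<inter> E = {}"
  shows "has_lebesgue_density \<gamma> F E z 0"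
  unfolding has_lebesgue_density_def
proof (rule tendsto_eventually)
  from eventually_cm_ball_subset[OF z U(1)]
  show "\<forall>\<^sub>F r in at_right 0. measure vol (E \<inter> cm_ball \<gamma> F z r) / measure vol (cm_ball \<gamma> F z r) = 0"
  proof eventually_elim
    case (elim r)
    then have "E \<inter> cm_ball \<gamma> F z r = {}"
      using U by auto
    then show ?case by simp
  qed
qed

text \<open>Shrinking a cube around \<open>p\<close> towards the vertex \<open>z\<close> leaves in
  each small ball a cube of side proportional to \<open>r\<close>, while the ball lies in a cube of
  half-side \<open>r\<close>. The ratio of the two volumes does not depend on
  \<open>r\<close>.\<close>

lemma cone_lower_density:
  assumes z: "z \<in> F" and a: "a > 0" and E: "E \<in> sets borel"
    and cone: "\<And>s. 0 < s \<Longrightarrow> s \<le> 1 \<Longrightarrow> cube (z + s *\<^sub>R (p - z)) (s * a) \<subseteq> E"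
  obtains c where "c > 0"
    "\<forall>\<^sub>F r in at_right 0. c * measure vol (cm_ball \<gamma> F z r) \<le> measure vol (E \<inter> cm_ball \<gamma> F z r)"
proof -
  \<comment> \<open>With \<open>s = r / R\<close> the shrunken cube fits into the ball of radius
    \<open>r\<close>. The added 1 makes the inclusion estimate strict and \<open>R\<close>
    positive.\<close>
  define R where "R = (\<Sum>h\<in>B. \<bar>hat Q h (p - z)\<bar>) + real (card B) * a + 1"
  have R: "R > 0"
    unfolding R_def using a by (intro add_nonneg_pos add_nonneg_nonneg sum_nonneg) auto
  define c where "c = (a / R) ^ card B"
  have c: "c > 0" using a R by (simp add: c_def)
  have "c * measure vol (cm_ball \<gamma> F z r) \<le> measure vol (E \<inter> cm_ball \<gamma> F z r)"
    if r: "0 < r" "r < R" for r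
  proof -
    define s where "s = r / R"
    have s: "0 < s" "s \<le> 1" and rs: "r = s * R"
      using r R by (simp_all add: s_def)
    let ?C = "cube (z + s *\<^sub>R (p - z)) (s * a)"
    have "(\<Sum>h\<in>B. \<bar>hat Q h (z + s *\<^sub>R (p - z) - z)\<bar>) + real (card B) * (s * a) = s * (R - 1)"
      using s by (simp add: R_def blinfun.scaleR_right abs_mult distrib_left flip: sum_distrib_left)
    also have "\<dots> < r"
      using s by (simp add: rs)
    finally have "?C \<subseteq> cm_ball \<gamma> F z r"
      by (rule cube_subset_cm_ball[OF z])
    then have C: "?C \<subseteq> E \<inter> cm_ball \<gamma> F z r"
      using cone s by blast
    have "c * measure vol (cm_ball \<gamma> F z r) \<le> c * (2 * r) ^ card B"
      using c measure_cm_ball_le[OF z r(1)] by (intro mult_left_mono) auto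
    also have "\<dots> = (a / R * (2 * r)) ^ card B"
      by (simp only: c_def power_mult_distrib)
    also have "a / R * (2 * r) = 2 * (s * a)"
      using R by (simp add: rs)
    also have "(2 * (s * a)) ^ card B = measure vol ?C"
      using s a by (simp add: measure_cube)
    also have "\<dots> \<le> measure vol (E \<inter> cm_ball \<gamma> F z r)"
      using C z r(1) E
      by (intro measure_mono_fmeasurable fmeasurable_Int_cm_ball sets_lebesgue_on_subspace) auto
    finally show ?thesis .
  qed
  moreover have "\<forall>\<^sub>F r in at_right 0. 0 < r \<and> r < R"
    using R by (auto simp: eventually_at_right_field intro!: exI[of _ R])
  ultimately have "\<forall>\<^sub>F r in at_right 0.
      c * measure vol (cm_ball \<gamma> F z r) \<le> measure vol (E \<inter> cm_ball \<gamma> F z r)"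
    by (auto elim: eventually_mono)
  with c show thesis by (rule that)
qed

lemma not_has_lebesgue_density_0:
  assumes z: "z \<in> F" and a: "a > 0" and E: "E \<in> sets borel"
    and cone: "\<And>s. 0 < s \<Longrightarrow> s \<le> 1 \<Longrightarrow> cube (z + s *\<^sub>R (p - z)) (s * a) \<subseteq> E"
  shows "\<not> has_lebesgue_density \<gamma> F E z 0"
proof
  assume dens: "has_lebesgue_density \<gamma> F E z 0"
  obtain c where c: "c > 0"
    "\<forall>\<^sub>F r in at_right 0. c * measure vol (cm_ball \<gamma> F z r) \<le> measure vol (E \<inter> cm_ball \<gamma> F z r)"
    using cone_lower_density[OF assms] by blast
  have "\<forall>\<^sub>F r in at_right (0::real). r > 0"
    by (simp add: eventually_at_right_less)
  with c(2) have "\<forall>\<^sub>F r in at_right 0.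
      c \<le> measure vol (E \<inter> cm_ball \<gamma> F z r) / measure vol (cm_ball \<gamma> F z r)"
  proof eventually_elim
    case (elim r)
    with measure_cm_ball_pos[OF z elim(2)] show ?case by (simp add: field_simps)
  qed
  from tendsto_lowerbound[OF dens[unfolded has_lebesgue_density_def] this] c(1)
  show False by simp
qed

text \<open>The disjoint set \<open>E'\<close> takes at least a fixed fraction \<open>c\<close> of
  every small ball, which leaves at most \<open>1 - c\<close> for \<open>E\<close>.\<close>

lemma not_has_lebesgue_density_1:
  assumes z: "z \<in> F" and a: "a > 0" and E: "E \<in> sets borel" "E' \<in> sets borel" "E \<inter> E' = {}"
    and cone: "\<And>s. 0 < s \<Longrightarrow> s \<le> 1 \<Longrightarrow> cube (z + s *\<^sub>R (p - z)) (s * a) \<subseteq> E'"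
  shows "\<not> has_lebesgue_density \<gamma> F E z 1"
proof
  assume dens: "has_lebesgue_density \<gamma> F E z 1"
  obtain c where c: "c > 0"
    "\<forall>\<^sub>F r in at_right 0. c * measure vol (cm_ball \<gamma> F z r) \<le> measure vol (E' \<inter> cm_ball \<gamma> F z r)"
    using cone_lower_density[OF z a E(2) cone] by blast
  have "\<forall>\<^sub>F r in at_right (0::real). r > 0"
    by (simp add: eventually_at_right_less)
  with c(2) have "\<forall>\<^sub>F r in at_right 0.
      measure vol (E \<inter> cm_ball \<gamma> F z r) / measure vol (cm_ball \<gamma> F z r) \<le> 1 - c"
  proof eventually_elim
    case (elim r)
    let ?b = "cm_ball \<gamma> F z r"
    note fm = fmeasurable_Int_cm_ball[OF z elim(2)]
    have "measure vol (E \<inter> ?b) + measure vol (E' \<inter> ?b) = measure vol (E \<inter> ?b \<union> E' \<inter> ?b)"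
      using fm[OF E(1)] fm[OF E(2)] E(3) by (intro measure_Union[symmetric]) (auto simp: fmeasurable_def)
    also have "\<dots> \<le> measure vol ?b"
      using fm[OF E(1)] fm[OF E(2)] fmeasurable_cm_ball[OF z elim(2)]
      by (intro measure_mono_fmeasurable) auto
    finally have "measure vol (E \<inter> ?b) \<le> (1 - c) * measure vol ?b"
      using elim(1) by (simp add: algebra_simps)
    with measure_cm_ball_pos[OF z elim(2)] show ?case by (simp add: field_simps)
  qed
  from tendsto_upperbound[OF dens[unfolded has_lebesgue_density_def] this] c(1)
  show False by simp
qed

lemma open_contains_cube:
  assumes p: "p \<in> F" "p \<in> U" and U: "open U"
  obtains a where "a > 0" "cube p a \<subseteq> U"
proof -
  have "\<forall>\<^sub>F r in at_right (0::real). r > 0"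
    by (simp add: eventually_at_right_less)
  with eventually_cm_ball_subset[OF p U]
  have "\<forall>\<^sub>F r in at_right 0. cm_ball \<gamma> F p r \<subseteq> U \<and> r > 0"
    by (rule eventually_conj)
  from eventually_happens'[OF trivial_limit_at_right_real this]
  obtain r where r: "cm_ball \<gamma> F p r \<subseteq> U" "r > 0"
    by blast
  have "real (card B) * (r / (card B + 1)) < r"
    using r by (simp add: field_simps)
  then have "cube p (r / (card B + 1)) \<subseteq> cm_ball \<gamma> F p r"
    using p by (intro cube_subset_cm_ball) simp_all
  with r show thesis
    by (intro that[of "r / (card B + 1)"]) auto
qed

text \<open>Undoes the homothety with centre \<open>z\<close> and ratio \<open>s\<close>, which maps
  the cube around \<open>p\<close> onto the shrunken one.\<close>

lemma cube_scale:
  assumes w: "w \<in> cube (z + s *\<^sub>R (p - z)) (s * a)" and s: "s > 0" and z: "z \<in> F"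
  obtains q where "q \<in> cube p a" "w = z + s *\<^sub>R (q - z)"
proof -
  define q where "q = z + (w - z) /\<^sub>R s"
  have eq: "w = z + s *\<^sub>R (q - z)"
    using s by (simp add: q_def)
  have qF: "q \<in> F"
    unfolding q_def using w z
    by (intro subspace_add subspace_scale subspace_diff subspace_F) (auto simp: cube_def)
  have "\<bar>hat Q h (q - p)\<bar> \<le> a" if h: "h \<in> B" for h
  proof -
    have "w - (z + s *\<^sub>R (p - z)) = s *\<^sub>R (q - p)"
      by (simp add: eq algebra_simps)
    then have "s * \<bar>hat Q h (q - p)\<bar> \<le> s * a"
      using w h s by (simp add: cube_def blinfun.scaleR_right abs_mult)
    then show ?thesis using s by simp
  qed
  with qF eq show thesis
    by (intro that[of q]) (simp_all add: cube_def)
qed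

end

text \<open>The limit point \<open>x\<close> is replaced by a nearby \<open>x'\<close> in the set,
  and the error is moved to the other endpoint, where the ball around \<open>p\<close> absorbs
  it.\<close>

lemma open_convex_closure_segment:
  fixes \<Omega> :: "'a::real_normed_vector set"
  assumes \<Omega>: "open \<Omega>" "convex \<Omega>" and x: "x \<in> closure \<Omega>" and p: "p \<in> \<Omega>"
    and s: "0 < s" "s \<le> 1"
  shows "x + s *\<^sub>R (p - x) \<in> \<Omega>"
proof (cases "s = 1")
  case False
  with s have s: "0 < s" "s < 1" by simp_all
  obtain e where e: "e > 0" "ball p e \<subseteq> \<Omega>"
    using \<Omega> p by (auto simp: open_contains_ball)
  have "s * e / (1 - s) > 0"
    using s e by simp
  then obtain x' where x': "x' \<in> \<Omega>" "dist x' x < s * e / (1 - s)"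
    using x unfolding closure_approachable by blast
  \<comment> \<open>Solves \<open>(1 - s) *\<^sub>R x' + s *\<^sub>R q = x + s *\<^sub>R (p -
    x)\<close>; the tolerance for \<open>x'\<close> is exactly what keeps \<open>q\<close> within
    \<open>e\<close> of \<open>p\<close>.\<close>
  define q where "q = p + ((1 - s) / s) *\<^sub>R (x - x')"
  have "norm (q - p) = (1 - s) / s * dist x' x"
    using s by (simp add: q_def dist_norm norm_minus_commute)
  also have "\<dots> < e"
    using x'(2) s by (simp add: field_simps)
  finally have "norm (q - p) < e" .
  then have "q \<in> \<Omega>"
    using e by (auto simp: dist_norm norm_minus_commute subset_eq)
  with x' \<Omega>(2) s have "(1 - s) *\<^sub>R x' + s *\<^sub>R q \<in> \<Omega>"
    by (intro convexD) auto
  also have "s *\<^sub>R q = s *\<^sub>R p + (1 - s) *\<^sub>R (x - x')"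
    using s by (simp add: q_def scaleR_add_right)
  also have "(1 - s) *\<^sub>R x' + \<dots> = x + s *\<^sub>R (p - x)"
    by (simp add: algebra_simps)
  finally show ?thesis .
qed (use p in simp)

section \<open>Finite-dimensional sections of open and convex sets\<close>

context cm_subspace
begin

lemma section_at_borel: "open \<Omega> \<Longrightarrow> section_at F \<Omega> y \<in> sets borel"
proof -
  assume "open \<Omega>"
  then have "open ((\<lambda>z. y + z) -` \<Omega>)"
    by (intro continuous_open_vimage continuous_intros)
  moreover have "section_at F \<Omega> y = F \<inter> (\<lambda>z. y + z) -` \<Omega>"
    by (auto simp: section_at_def)
  ultimately show ?thesis
    using closed_F by auto
qed

lemma essential_boundary_section_frontier:
  assumes \<Omega>: "open \<Omega>" and z: "z \<in> essential_boundary \<gamma> F (section_at F \<Omega> y)"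
  shows "y + z \<in> frontier \<Omega>"
proof -
  have zF: "z \<in> F" and nd: "\<not> has_lebesgue_density \<gamma> F (section_at F \<Omega> y) z 0"
    "\<not> has_lebesgue_density \<gamma> F (section_at F \<Omega> y) z 1"
    using z by (auto simp: essential_boundary_def)
  have op: "open ((\<lambda>z. y + z) -` S)" if "open S" for S :: "'a set"
    using that by (intro continuous_open_vimage continuous_intros)
  have "y + z \<notin> \<Omega>"
    using has_lebesgue_density_1_interior[OF zF _ op[OF \<Omega>], of "section_at F \<Omega> y"] nd
    by (auto simp: section_at_def)
  moreover have "y + z \<in> closure \<Omega>"
  proof (rule ccontr)
    assume "y + z \<notin> closure \<Omega>"
    then show False
      using has_lebesgue_density_0_exterior[OF zF _ op[of "- closure \<Omega>"], of "section_at F \<Omega> y"]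
        nd closure_subset[of \<Omega>] by (auto simp: section_at_def)
  qed
  ultimately show ?thesis
    using \<Omega> by (simp add: frontier_def interior_open)
qed

lemma frontier_essential_boundary_section:
  assumes \<Omega>: "open \<Omega>" "convex \<Omega>" and yz: "y + z \<in> frontier \<Omega>" and z: "z \<in> F"
    and p: "p \<in> F" "y + p \<in> \<Omega>"
  shows "z \<in> essential_boundary \<gamma> F (section_at F \<Omega> y)"
proof -
  let ?E = "section_at F \<Omega> y"
  \<comment> \<open>The reflection of the section through \<open>z\<close>; it contains the
    reflected cone, whose axis points to \<open>2 *\<^sub>R z - p\<close>.\<close>
  define E' where "E' = {w \<in> F. 2 *\<^sub>R z - w \<in> ?E}"
  have cl: "y + z \<in> closure \<Omega>" and notin: "y + z \<notin> \<Omega>"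
    using yz \<Omega>(1) by (auto simp: frontier_def interior_open)
  have E: "?E \<in> sets borel"
    by (rule section_at_borel[OF \<Omega>(1)])
  have "open ((\<lambda>z. y + z) -` \<Omega>)"
    using \<Omega>(1) by (intro continuous_open_vimage continuous_intros)
  then obtain a where a: "a > 0" "cube p a \<subseteq> (\<lambda>z. y + z) -` \<Omega>"
    using open_contains_cube[OF p(1), of "(\<lambda>z. y + z) -` \<Omega>"] p(2) by auto
  have cone: "cube (z + s *\<^sub>R (p - z)) (s * a) \<subseteq> ?E" if s: "0 < s" "s \<le> 1" for s
  proof
    fix w assume w: "w \<in> cube (z + s *\<^sub>R (p - z)) (s * a)"
    obtain q where q: "q \<in> cube p a" "w = z + s *\<^sub>R (q - z)"
      using cube_scale[OF w s(1) z] .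
    then have "(y + z) + s *\<^sub>R ((y + q) - (y + z)) \<in> \<Omega>"
      using a(2) by (intro open_convex_closure_segment[OF \<Omega> cl] s) auto
    then show "w \<in> ?E"
      using w q by (simp add: section_at_def cube_def add.assoc)
  qed
  have "E' = F \<inter> (\<lambda>w. y + (2 *\<^sub>R z - w)) -` \<Omega>"
    using z by (auto simp: E'_def section_at_def intro: subspace_diff[OF subspace_F] subspace_scale[OF subspace_F])
  moreover have "open ((\<lambda>w. y + (2 *\<^sub>R z - w)) -` \<Omega>)"
    using \<Omega>(1) by (intro continuous_open_vimage continuous_intros)
  ultimately have E': "E' \<in> sets borel"
    using closed_F by auto
  have cone': "cube (z + s *\<^sub>R ((2 *\<^sub>R z - p) - z)) (s * a) \<subseteq> E'" if s: "0 < s" "s \<le> 1" for s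
  proof
    fix w assume w: "w \<in> cube (z + s *\<^sub>R ((2 *\<^sub>R z - p) - z)) (s * a)"
    have "2 *\<^sub>R z - w - (z + s *\<^sub>R (p - z)) = - (w - (z + s *\<^sub>R ((2 *\<^sub>R z - p) - z)))"
      by (simp add: algebra_simps scaleR_2)
    then have "2 *\<^sub>R z - w \<in> cube (z + s *\<^sub>R (p - z)) (s * a)"
      using w z unfolding cube_def
      by (auto simp only: blinfun.minus_right abs_minus_cancel
          intro: subspace_diff[OF subspace_F] subspace_scale[OF subspace_F])
    with cone[OF s] w show "w \<in> E'"
      by (auto simp: E'_def cube_def)
  qed
  \<comment> \<open>For a common point \<open>w\<close>, convexity would put the midpoint of
    \<open>y + w\<close> and its mirror image into the set; but that midpoint is the boundary point
    \<open>y + z\<close>.\<close>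
  have "?E \<inter> E' = {}"
  proof (rule ccontr)
    assume "?E \<inter> E' \<noteq> {}"
    then obtain w where "y + w \<in> \<Omega>" "y + (2 *\<^sub>R z - w) \<in> \<Omega>"
      by (auto simp: E'_def section_at_def)
    with \<Omega>(2) have "(1/2) *\<^sub>R (y + w) + (1/2) *\<^sub>R (y + (2 *\<^sub>R z - w)) \<in> \<Omega>"
      by (intro convexD) auto
    also have "(1/2) *\<^sub>R (y + w) + (1/2) *\<^sub>R (y + (2 *\<^sub>R z - w)) = y + z"
      by (simp add: algebra_simps flip: scaleR_left_distrib)
    finally show False using notin by simp
  qed
  with not_has_lebesgue_density_0[OF z a(1) E cone]
    not_has_lebesgue_density_1[OF z a(1) E E' _ cone'] z
  show ?thesis
    by (simp add: essential_boundary_def)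
qed

end

section \<open>The essential boundary of a convex set\<close>

theorem lemma4p6:
  fixes \<gamma> :: "'a::{banach, second_countable_topology} measure"
    and Q :: "('a \<Rightarrow>\<^sub>L real) \<Rightarrow>\<^sub>L 'a"
    and \<Omega> :: "'a set"
    and \<F> :: "'a set set"
  assumes "abstract_wiener_space \<gamma> Q"
    and "open \<Omega>" and "convex \<Omega>"
    and "countable \<F>"
    and "\<And>F. F \<in> \<F> \<Longrightarrow> subspace F \<and> (\<exists>B. finite B \<and> span B = F) \<and> F \<subseteq> range (blinfun_apply Q)"
    and "\<And>\<G>. finite \<G> \<Longrightarrow> \<G> \<noteq> {} \<Longrightarrow> \<G> \<subseteq> \<F> \<Longrightarrow> span (\<Union>\<G>) \<in> \<F>"
    and "cm_dense \<gamma> (\<Union>\<F>)"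
  shows "family_essential_boundary \<gamma> Q \<F> \<Omega> = frontier \<Omega>"
proof
  interpret abstract_wiener_space \<gamma> Q by fact
  have cm: "cm_subspace \<gamma> Q F" if "F \<in> \<F>" for F
    using assms(5)[OF that] by unfold_locales auto
  show "family_essential_boundary \<gamma> Q \<F> \<Omega> \<subseteq> frontier \<Omega>"
  proof
    fix x assume "x \<in> family_essential_boundary \<gamma> Q \<F> \<Omega>"
    then obtain F where F: "F \<in> \<F>" "x \<in> subspace_essential_boundary \<gamma> Q F \<Omega>"
      by (auto simp: family_essential_boundary_def)
    interpret cm_subspace \<gamma> Q F by (rule cm[OF F(1)])
    show "x \<in> frontier \<Omega>"
      using F(2) essential_boundary_section_frontier[OF assms(2)]
      by (auto simp: subspace_essential_boundary_def)
  qed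
  show "frontier \<Omega> \<subseteq> family_essential_boundary \<gamma> Q \<F> \<Omega>"
  proof
    fix x assume x: "x \<in> frontier \<Omega>"
    have dense: "closure (\<Union>\<F>) = UNIV"
    proof (rule cm_dense_imp_dense)
      have "0 \<in> cm_space \<gamma>"
        using range_Q_subset_cm_space subspace_0[OF subspace_range_Q] by blast
      \<comment> \<open>Approximating 0 already requires a member of the union, so the family is
        nonempty.\<close>
      then obtain F0 where F0: "F0 \<in> \<F>"
        using assms(7) unfolding cm_dense_def by (metis Union_iff zero_less_one)
      show "subspace (\<Union>\<F>)"
      proof (rule subspaceI)
        show "0 \<in> \<Union>\<F>"
          using F0 assms(5)[OF F0] subspace_0 by blast
        show "c *\<^sub>R u \<in> \<Union>\<F>" if "u \<in> \<Union>\<F>" for c u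
          using that assms(5) subspace_scale by blast
        \<comment> \<open>The union is closed under addition because the family is directed: the
          span of two members is again a member.\<close>
        show "u + v \<in> \<Union>\<F>" if u: "u \<in> \<Union>\<F>" and v: "v \<in> \<Union>\<F>" for u v
        proof -
          from u v obtain F G where FG: "F \<in> \<F>" "u \<in> F" "G \<in> \<F>" "v \<in> G" by blast
          then have "span (\<Union>{F, G}) \<in> \<F>"
            by (intro assms(6)) auto
          moreover have "u + v \<in> span (\<Union>{F, G})"
            using FG by (intro span_add span_base) auto
          ultimately show ?thesis by blast
        qed
      qed
      show "\<Union>\<F> \<subseteq> range (blinfun_apply Q)"
        using assms(5) by blast
    qed (rule assms(7))
    have "\<Omega> \<noteq> {}" using x by auto
    then obtain v where v: "v \<in> \<Omega>" by blast
    have "open ((\<lambda>d. x + d) -` \<Omega>)"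
      using assms(2) by (intro continuous_open_vimage continuous_intros)
    moreover have "v - x \<in> (\<lambda>d. x + d) -` \<Omega> \<inter> closure (\<Union>\<F>)"
      using v dense by simp
    ultimately have "(\<lambda>d. x + d) -` \<Omega> \<inter> \<Union>\<F> \<noteq> {}"
      using open_Int_closure_eq_empty by blast
    then obtain d F where d: "x + d \<in> \<Omega>" "d \<in> F" "F \<in> \<F>" by blast
    have "x \<in> subspace_essential_boundary \<gamma> Q G \<Omega>" if G: "G \<in> \<F>" "F \<subseteq> G" for G
    proof -
      interpret cm_subspace \<gamma> Q G by (rule cm[OF G(1)])
      let ?z = "cm_proj \<gamma> Q G x"
      have "cm_proj \<gamma> Q G (x - ?z) = 0"
        by (simp add: cm_proj_diff cm_proj_ident cm_proj_in)
      moreover have "?z \<in> essential_boundary \<gamma> G (section_at G \<Omega> (x - ?z))"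
      proof (rule frontier_essential_boundary_section[OF assms(2,3)])
        \<comment> \<open>The interior point of the section is \<open>?z + d\<close>: added to the
          kernel part \<open>x - ?z\<close> it gives \<open>x + d\<close>, which lies in the convex
          set.\<close>
        show "?z + d \<in> G"
          using d G by (intro subspace_add[OF subspace_F] cm_proj_in) auto
      qed (use x d cm_proj_in in simp_all)
      ultimately show ?thesis
        unfolding subspace_essential_boundary_def by force
    qed
    with d(3) show "x \<in> family_essential_boundary \<gamma> Q \<F> \<Omega>"
      by (auto simp: family_essential_boundary_def)
  qed
qed

end
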